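(* Let $\mathcal{P}=(p_1,p_2,\dots)$ be a probability distribution on $\mathbb{N}$ with $p_1\ge p_2\ge p_3\ge\cdots$ and with unbounded support, and consider the Binary Flipping (BF) model with distribution $\mathcal{P}$ and return time $\tau_{\mathrm{BF}}$ to the ground state. When the BF model is recurrent, it is null-recurrent; that is, $\mathbf{E}\,\tau_{\mathrm{BF}}=\infty$ always.
   Context: $\mathbb{N}=\{1,2,\dots\}$. Binary Flipping (BF) model: let $\chi_1,\chi_2,\dots$ be i.i.d. random variables with $\mathbf{P}(\chi_i=k)=p_k$, $k\in\mathbb{N}$. The BF model is the discrete-time Markov chain $\zeta_n=(\zeta_n^1,\zeta_n^2,\dots)$, $n\ge 0$, with values in $\mathcal{X}=\{x\in\{0,1\}^{\mathbb{N}}: x\text{ has finitely many non-zeros}\}$, started from the ground state $\zeta_0=\mathbf{0}=(0,0,\dots)$, with $$\zeta^k_{n+1}=\begin{cases}\zeta^k_n,& k\ne\chi_{n+1},\\ 1-\zeta^k_n,& k=\chi_{n+1},\end{cases}\qquad k\in\mathbb{N},\ n\ge 0.$$ The return time is $\tau_{\mathrm{BF}}=\min\{n\ge 1:\zeta_n^k=0\ \text{for all }k\in\mathbb{N}\}$, with $\tau_{\mathrm{BF}}=\infty$ if no such $n$ exists. The model is recurrent if $\mathbf{P}(\tau_{\mathrm{BF}}<\infty)=1$; it is null-recurrent if it is recurrent and $\mathbf{E}\,\tau_{\mathrm{BF}}=\infty$. *)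

theory Defs
  imports "HOL-Probability.Probability"
begin

text \<open>
  The paper's natural numbers start at 1.  Coordinates of the chain and indices of the
  driving variables have type \<^typ>\<open>nat\<close> here, and index 0 is never used: a law on the positive
  integers is a \<^typ>\<open>nat pmf\<close> without mass at 0, and coordinate 0 of a state is ignored.
\<close>

definition iid_with_law :: "'a measure \<Rightarrow> nat pmf \<Rightarrow> (nat \<Rightarrow> 'a \<Rightarrow> nat) \<Rightarrow> bool" where
  "iid_with_law M p X \<longleftrightarrow>
     prob_space M \<and>
     prob_space.indep_vars M (\<lambda>_. count_space UNIV) X {1..} \<and>
     (\<forall>i\<ge>1. \<forall>k. measure M {\<omega> \<in> space M. X i \<omega> = k} = pmf p k)"

text \<open>\<open>bf_chain X n \<omega> k\<close> is the k-th coordinate of the state after n steps, driven by X 1, X 2, ...\<close>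

primrec bf_chain :: "(nat \<Rightarrow> 'a \<Rightarrow> nat) \<Rightarrow> nat \<Rightarrow> 'a \<Rightarrow> nat \<Rightarrow> int" where
  "bf_chain X 0 \<omega> = (\<lambda>k. 0)"
| "bf_chain X (Suc n) \<omega> =
     (\<lambda>k. if k = X (Suc n) \<omega> then 1 - bf_chain X n \<omega> k else bf_chain X n \<omega> k)"

lemma bf_chain_values: "bf_chain X n \<omega> k \<in> {0, 1}"
  by (induction n) auto

lemma bf_chain_finite_support: "finite {k. bf_chain X n \<omega> k \<noteq> 0}"
proof (induction n)
  case (Suc n)
  have "{k. bf_chain X (Suc n) \<omega> k \<noteq> 0} \<subseteq> insert (X (Suc n) \<omega>) {k. bf_chain X n \<omega> k \<noteq> 0}"
    by auto
  with Suc show ?case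
    by (meson finite_insert finite_subset)
qed simp

text \<open>The infimum of the empty set in \<^typ>\<open>enat\<close> is \<open>\<infinity>\<close>; otherwise it is the minimum.\<close>

definition bf_return_time :: "(nat \<Rightarrow> 'a \<Rightarrow> nat) \<Rightarrow> 'a \<Rightarrow> enat" where
  "bf_return_time X \<omega> = Inf {enat n | n. n \<ge> 1 \<and> (\<forall>k\<ge>1. bf_chain X n \<omega> k = 0)}"

definition bf_expected_return_time :: "'a measure \<Rightarrow> (nat \<Rightarrow> 'a \<Rightarrow> nat) \<Rightarrow> ennreal" where
  "bf_expected_return_time M X = (\<integral>\<^sup>+ \<omega>. ennreal_of_enat (bf_return_time X \<omega>) \<partial>M)"

definition bf_recurrent :: "'a measure \<Rightarrow> (nat \<Rightarrow> 'a \<Rightarrow> nat) \<Rightarrow> bool" where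
  "bf_recurrent M X \<longleftrightarrow> measure M {\<omega> \<in> space M. bf_return_time X \<omega> < \<infinity>} = 1"

definition bf_null_recurrent :: "'a measure \<Rightarrow> (nat \<Rightarrow> 'a \<Rightarrow> nat) \<Rightarrow> bool" where
  "bf_null_recurrent M X \<longleftrightarrow> bf_recurrent M X \<and> bf_expected_return_time M X = \<infinity>"

end

theory Submission
  imports Defs
begin

text \<open>
  Why the expected return time is infinite.  The state of the chain after \<open>n\<close> steps records the
  parities of the letters of the random word \<open>X 1 \<dots> X n\<close>, so the chain is at the ground
  state exactly when this word is closed, that is, contains every letter an even number of times.
  Two sequences matter: \<open>u n\<close> (\<open>closed_prob\<close>), the probability that a word of \<open>n\<close> independent
  letters is closed, and \<open>q n\<close> (\<open>return_free_prob\<close>), the probability that none of its nonempty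
  prefixes is closed, which is the probability that the return time exceeds \<open>n\<close>.

  Split a word of length \<open>N\<close> at its last closed prefix.  The rest of the word then has no nonempty
  closed prefix, and the two parts are independent, so
  \<open>u 0 * q N + u 1 * q (N - 1) + \<dots> + u N * q 0 = 1\<close> for every \<open>N\<close> (\<open>renewal_identity\<close>).

  On the other hand \<open>u n\<close> tends to 0 (\<open>closed_prob_tendsto_0\<close>).  Indeed, if \<open>B\<close> is a set of \<open>m\<close>
  letters of positive probability, then Fourier analysis on the group of parity vectors indexed
  by \<open>B\<close> gives the probability that all letters of \<open>B\<close> occur an even number of times as
  the average of \<open>(1 - 2 * P A) ^ n\<close> over the \<open>2 ^ m\<close> subsets \<open>A\<close> of \<open>B\<close>, where \<open>P A\<close> is the
  probability that a letter lies in \<open>A\<close>.  Since infinitely many letters have positive probability,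
  \<open>0 < P A < 1\<close> for nonempty \<open>A\<close>, so only the term of the empty set survives
  in the limit, which is \<open>1 / 2 ^ m\<close>; and \<open>m\<close> is arbitrary.

  If the return time had finite expectation, its tail probabilities \<open>q n\<close> would be
  summable.  By dominated convergence the left-hand side of the renewal identity would tend
  to 0, yet it is constantly 1.
\<close>

section \<open>Words and renewal at the last closed prefix\<close>

definition closed_word :: "nat list \<Rightarrow> bool" where
  "closed_word xs \<longleftrightarrow> (\<forall>k\<ge>1. even (count_list xs k))"

definition return_free :: "nat list \<Rightarrow> bool" where
  "return_free xs \<longleftrightarrow> (\<forall>j\<in>{1..length xs}. \<not> closed_word (take j xs))"

definition closed_prob :: "nat pmf \<Rightarrow> nat \<Rightarrow> real" where
  "closed_prob p n = measure (replicate_pmf n p) {xs. closed_word xs}"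

definition return_free_prob :: "nat pmf \<Rightarrow> nat \<Rightarrow> real" where
  "return_free_prob p n = measure (replicate_pmf n p) {xs. return_free xs}"

lemma integrable_indicator_pmf [simp]:
  "integrable (measure_pmf q) (indicator A :: 'b \<Rightarrow> real)"
  by (rule measure_pmf.integrable_const_bound[where B = 1]) (auto simp: indicator_def)

lemma replicate_pmf_Suc_pair:
  "replicate_pmf (Suc n) p = map_pmf (\<lambda>(x, xs). x # xs) (pair_pmf p (replicate_pmf n p))"
  by (simp add: pair_pmf_def map_pmf_def bind_return_pmf bind_assoc_pmf)

lemma replicate_pmf_add_pair:
  "replicate_pmf (m + n) p =
     map_pmf (\<lambda>(xs, ys). xs @ ys) (pair_pmf (replicate_pmf m p) (replicate_pmf n p))"
  by (simp add: pair_pmf_def replicate_pmf_distrib map_pmf_def bind_return_pmf bind_assoc_pmf)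

text \<open>The two parts of a random word, cut at a fixed place, are independent random words.\<close>

lemma prob_take_drop:
  fixes p :: "nat pmf"
  shows "measure (replicate_pmf (m + n) p) {xs. P (take m xs) \<and> Q (drop m xs)} =
         measure (replicate_pmf m p) {xs. P xs} * measure (replicate_pmf n p) {xs. Q xs}"
proof -
  let ?pp = "pair_pmf (replicate_pmf m p) (replicate_pmf n p)"
  have "measure (replicate_pmf (m + n) p) {xs. P (take m xs) \<and> Q (drop m xs)} =
        measure ?pp {(xs, ys). P (take m (xs @ ys)) \<and> Q (drop m (xs @ ys))}"
    by (simp add: replicate_pmf_add_pair vimage_def case_prod_unfold)
  also have "\<dots> = measure ?pp ({xs. P xs} \<times> {ys. Q ys})"
    by (rule measure_pmf.finite_measure_eq_AE)
       (auto simp: AE_measure_pmf_iff set_replicate_pmf)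
  also have "\<dots> = measure (replicate_pmf m p) {xs. P xs} * measure (replicate_pmf n p) {xs. Q xs}"
    by (rule measure_pmf_prob_product) auto
  finally show ?thesis .
qed

lemma closed_word_append_iff:
  "closed_word xs \<Longrightarrow> closed_word (xs @ ys) \<longleftrightarrow> closed_word ys"
  by (auto simp: closed_word_def)

text \<open>
  The empty prefix is closed, so there is a longest closed prefix.  Removing a closed prefix does
  not change the closedness of longer prefixes, so what follows it is free of returns exactly
  if the removed prefix is the longest one.
\<close>

lemma last_closed_prefix_unique:
  "\<exists>!n. n \<le> length xs \<and> closed_word (take n xs) \<and> return_free (drop n xs)"
proof -
  let ?C = "{n. n \<le> length xs \<and> closed_word (take n xs)}"
  have fin: "finite ?C"
    by (rule finite_subset[of _ "{..length xs}"]) auto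
  have "0 \<in> ?C"
    by (simp add: closed_word_def)
  then have max: "Max ?C \<in> ?C"
    using Max_in[OF fin] by blast
  have iff: "return_free (drop n xs) \<longleftrightarrow> n = Max ?C" if n: "n \<in> ?C" for n
  proof -
    have closed: "closed_word (take j (drop n xs)) \<longleftrightarrow> closed_word (take (n + j) xs)" for j
      using n by (simp add: take_add closed_word_append_iff)
    show ?thesis
    proof
      assume rf: "return_free (drop n xs)"
      show "n = Max ?C"
      proof (rule ccontr)
        assume "n \<noteq> Max ?C"
        with Max_ge[OF fin n] have "n < Max ?C"
          by simp
        then have "Max ?C - n \<in> {1..length (drop n xs)}" "n + (Max ?C - n) = Max ?C"
          using max by auto
        with rf closed[of "Max ?C - n"] max show False
          by (auto simp: return_free_def)
      qed
    next
      assume eq: "n = Max ?C"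
      show "return_free (drop n xs)"
        unfolding return_free_def
      proof safe
        fix j assume "j \<in> {1..length (drop n xs)}" "closed_word (take j (drop n xs))"
        then have "n + j \<in> ?C" "j \<ge> 1"
          using closed n by auto
        with Max_ge[OF fin, of "n + j"] eq show False
          by simp
      qed
    qed
  qed
  show ?thesis
    by (rule ex1I[of _ "Max ?C"]) (use max iff in auto)
qed

text \<open>
  The events that the last closed prefix has length \<open>n\<close>, for \<open>n \<le> N\<close>, partition the words of
  length \<open>N\<close>, and each of them has a product as its probability.
\<close>

lemma renewal_identity:
  "(\<Sum>n\<le>N. closed_prob p n * return_free_prob p (N - n)) = 1"
proof -
  let ?R = "replicate_pmf N p"
  let ?E = "\<lambda>n. {xs. closed_word (take n xs) \<and> return_free (drop n xs)}"
  have "(\<Sum>n\<le>N. closed_prob p n * return_free_prob p (N - n)) = (\<Sum>n\<le>N. measure ?R (?E n))"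
  proof (rule sum.cong)
    fix n assume "n \<in> {..N}"
    then show "closed_prob p n * return_free_prob p (N - n) = measure ?R (?E n)"
      using prob_take_drop[of n "N - n" p closed_word return_free]
      by (simp add: closed_prob_def return_free_prob_def)
  qed simp
  also have "\<dots> = (\<integral>xs. (\<Sum>n\<le>N. indicator (?E n) xs) \<partial>?R)"
    by (subst Bochner_Integration.integral_sum) auto
  also have "\<dots> = (\<integral>xs. 1 \<partial>?R)"
  proof (rule integral_cong_AE)
    show "AE xs in ?R. (\<Sum>n\<le>N. indicator (?E n) xs) = (1 :: real)"
    proof (simp only: AE_measure_pmf_iff, intro ballI)
      fix xs assume "xs \<in> set_pmf ?R"
      then have len: "length xs = N"
        by (simp add: set_replicate_pmf)
      obtain m where m: "{n. n \<le> N \<and> xs \<in> ?E n} = {m}"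
        using last_closed_prefix_unique[of xs] len by auto
      have "(\<Sum>n\<le>N. indicator (?E n) xs) = (\<Sum>n\<in>{n. n \<le> N \<and> xs \<in> ?E n}. 1 :: real)"
        by (rule sum.mono_neutral_cong_right) auto
      then show "(\<Sum>n\<le>N. indicator (?E n) xs) = (1 :: real)"
        by (simp only: m) simp
    qed
  qed auto
  finally show ?thesis
    by simp
qed

section \<open>The probability of being at the ground state vanishes\<close>

text \<open>
  The left-hand side is the expectation of the character \<open>(-1) ^ (number of letters in A)\<close>, which
  is a product of independent signs, each of expectation \<open>1 - 2 * P A\<close>.  Writing it through the
  probability of an even number of letters in \<open>A\<close> turns the induction step into a case
  distinction on whether the first letter lies in \<open>A\<close>.
\<close>

lemma parity_character_expectation:
  fixes p :: "nat pmf"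
  shows "2 * measure (replicate_pmf n p) {xs. even (length (filter (\<lambda>x. x \<in> A) xs))} - 1 =
         (1 - 2 * measure p A) ^ n"
proof (induction n)
  case 0
  then show ?case by simp
next
  case (Suc n)
  let ?R = "replicate_pmf n p" and ?E = "{xs. even (length (filter (\<lambda>x. x \<in> A) xs))}"
  have "measure (replicate_pmf (Suc n) p) ?E =
        measure (pair_pmf p ?R) (A \<times> (- ?E) \<union> (- A) \<times> ?E)"
    unfolding replicate_pmf_Suc_pair measure_map_pmf
    by (rule arg_cong[where f = "measure _"]) (auto split: if_splits)
  also have "\<dots> = measure (pair_pmf p ?R) (A \<times> (- ?E)) + measure (pair_pmf p ?R) ((- A) \<times> ?E)"
    by (rule measure_pmf.finite_measure_Union) auto
  also have "\<dots> = measure p A * measure ?R (- ?E) + measure p (- A) * measure ?R ?E"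
    by (simp add: measure_pmf_prob_product)
  also have "measure ?R (- ?E) = 1 - measure ?R ?E"
    using measure_pmf.prob_compl[of ?E ?R] by (simp add: Compl_eq_Diff_UNIV)
  also have "measure p (- A) = 1 - measure p A"
    using measure_pmf.prob_compl[of A p] by (simp add: Compl_eq_Diff_UNIV)
  finally have step: "measure (replicate_pmf (Suc n) p) ?E =
      measure p A * (1 - measure ?R ?E) + (1 - measure p A) * measure ?R ?E" .
  have "2 * (a * (1 - e) + (1 - a) * e) - 1 = (1 - 2 * a) * (2 * e - 1)" for a e :: real
    by (simp add: algebra_simps)
  from this[of "measure p A" "measure ?R ?E"]
  have "2 * measure (replicate_pmf (Suc n) p) ?E - 1 = (1 - 2 * measure p A) * (2 * measure ?R ?E - 1)"
    by (simp only: step)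
  also have "2 * measure ?R ?E - 1 = (1 - 2 * measure p A) ^ n"
    by (rule Suc.IH)
  finally show ?case
    by (simp only: power_Suc)
qed

lemma length_filter_eq_sum_count_list:
  assumes "finite A"
  shows "length (filter (\<lambda>x. x \<in> A) xs) = (\<Sum>k\<in>A. count_list xs k)"
proof (induction xs)
  case (Cons a xs)
  have "(\<Sum>k\<in>A. count_list (a # xs) k) = (\<Sum>k\<in>A. count_list xs k + (if k = a then 1 else 0))"
    by (rule sum.cong) auto
  also have "\<dots> = (\<Sum>k\<in>A. count_list xs k) + (if a \<in> A then 1 else 0)"
    using assms by (simp add: sum.distrib)
  finally show ?case
    using Cons.IH by simp
qed simp

text \<open>
  Fourier inversion for the indicator of the zero parity vector: the product of the factors
  \<open>(-1) ^ count + 1\<close> over \<open>B\<close> is \<open>2 ^ card B\<close> if all counts are even and 0 otherwise,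
  and expanding it yields the sum of all characters.
\<close>

lemma even_indicator_fourier:
  assumes "finite B"
  shows "2 ^ card B * indicator {xs. \<forall>k\<in>B. even (count_list xs k)} xs =
         (\<Sum>A\<in>Pow B. 2 * indicator {xs. even (length (filter (\<lambda>x. x \<in> A) xs))} xs - (1 :: real))"
proof -
  let ?f = "\<lambda>k. (-1 :: real) ^ count_list xs k"
  have "2 ^ card B * indicator {xs. \<forall>k\<in>B. even (count_list xs k)} xs = (\<Prod>k\<in>B. ?f k + 1)"
  proof (cases "\<forall>k\<in>B. even (count_list xs k)")
    case False
    then obtain k where k: "k \<in> B" "?f k + 1 = 0"
      by auto
    with assms have "(\<Prod>k\<in>B. ?f k + 1) = 0"
      by (intro prod_zero) auto
    with False show ?thesis
      by simp
  qed simp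
  also have "\<dots> = (\<Sum>A\<in>Pow B. \<Prod>k\<in>A. ?f k)"
    by (simp add: prod_add[OF assms])
  also have "\<dots> = (\<Sum>A\<in>Pow B. 2 * indicator {xs. even (length (filter (\<lambda>x. x \<in> A) xs))} xs - 1)"
  proof (rule sum.cong)
    fix A assume "A \<in> Pow B"
    with assms have "finite A"
      using finite_subset by auto
    then have "(\<Prod>k\<in>A. ?f k) = (-1) ^ length (filter (\<lambda>x. x \<in> A) xs)"
      by (simp add: length_filter_eq_sum_count_list power_sum)
    then show "(\<Prod>k\<in>A. ?f k) =
               2 * indicator {xs. even (length (filter (\<lambda>x. x \<in> A) xs))} xs - 1"
      by (auto simp: indicator_def)
  qed simp
  finally show ?thesis .
qed

text \<open>The expectation of the Fourier expansion, taken character by character.\<close>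

lemma even_counts_prob:
  fixes p :: "nat pmf"
  assumes "finite B"
  shows "2 ^ card B * measure (replicate_pmf n p) {xs. \<forall>k\<in>B. even (count_list xs k)} =
         (\<Sum>A\<in>Pow B. (1 - 2 * measure p A) ^ n)"
proof -
  let ?R = "replicate_pmf n p"
  let ?E = "\<lambda>A. {xs. even (length (filter (\<lambda>x. x \<in> A) xs))}"
  have "2 ^ card B * measure ?R {xs. \<forall>k\<in>B. even (count_list xs k)} =
        (\<integral>xs. 2 ^ card B * indicator {xs. \<forall>k\<in>B. even (count_list xs k)} xs \<partial>?R)"
    by simp
  also have "\<dots> = (\<integral>xs. (\<Sum>A\<in>Pow B. 2 * indicator (?E A) xs - (1 :: real)) \<partial>?R)"
    by (simp only: even_indicator_fourier[OF assms])
  also have "\<dots> = (\<Sum>A\<in>Pow B. 2 * measure ?R (?E A) - 1)"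
    by (subst Bochner_Integration.integral_sum) auto
  finally show ?thesis
    by (simp only: parity_character_expectation)
qed

text \<open>
  A closed word contains each letter of a finite set of positive numbers evenly often.  For \<open>m\<close>
  such letters of positive probability this event has limiting probability \<open>1 / 2 ^ m\<close>: all
  characters except the trivial one have expectations decaying geometrically.
\<close>

lemma closed_prob_tendsto_0:
  assumes inf: "infinite (set_pmf p)"
  shows "closed_prob p \<longlonglongrightarrow> 0"
proof (rule LIMSEQ_I)
  fix e :: real assume e: "e > 0"
  obtain m where m: "(1 / 2) ^ m < e"
    using real_arch_pow_inv[OF e, of "1/2"] by auto
  \<comment> \<open>The letter 0 is avoided because closedness does not constrain its parity.\<close>
  obtain B where B: "B \<subseteq> set_pmf p - {0}" "finite B" "card B = m"
    using infinite_arbitrarily_large[of "set_pmf p - {0}" m] inf by auto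
  let ?v = "\<lambda>n. measure (replicate_pmf n p) {xs. \<forall>k\<in>B. even (count_list xs k)}"
  have pow: "(\<lambda>n. (1 - 2 * measure p A) ^ n) \<longlonglongrightarrow> (if A = {} then 1 else 0)" if A: "A \<in> Pow B" for A
  proof (cases "A = {}")
    case False
    then obtain a where a: "a \<in> A" by auto
    have "finite A"
      using A B finite_subset by auto
    \<comment> \<open>A letter outside of the finite set \<open>A\<close> excludes the value -1, where the powers oscillate.\<close>
    then have "set_pmf p - A \<noteq> {}"
      using Diff_infinite_finite[OF _ inf] by (metis finite.emptyI)
    then obtain b where b: "b \<in> set_pmf p" "b \<notin> A"
      by auto
    have "0 < pmf p a"
      using a A B by (auto simp: pmf_positive_iff)
    also have "pmf p a \<le> measure p A"
      unfolding pmf.rep_eq using a by (intro measure_pmf.finite_measure_mono) auto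
    finally have pos: "0 < measure p A" .
    have "0 < pmf p b"
      using b by (auto simp: pmf_positive_iff)
    also have "pmf p b \<le> measure p (- A)"
      unfolding pmf.rep_eq using b by (intro measure_pmf.finite_measure_mono) auto
    also have "\<dots> = 1 - measure p A"
      using measure_pmf.prob_compl[of A p] by (simp add: Compl_eq_Diff_UNIV)
    finally have "measure p A < 1"
      by simp
    with pos have "norm (1 - 2 * measure p A) < 1"
      by (simp add: abs_less_iff)
    then show ?thesis
      using False by (simp add: LIMSEQ_power_zero)
  qed simp
  have "(\<lambda>n. \<Sum>A\<in>Pow B. (1 - 2 * measure p A) ^ n) \<longlonglongrightarrow> (\<Sum>A\<in>Pow B. if A = {} then 1 else 0)"
    by (intro tendsto_sum pow)
  also have "(\<Sum>A\<in>Pow B. if A = {} then 1 else 0) = (1 :: real)"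
    using B by (simp add: sum.delta')
  finally have "(\<lambda>n. 2 ^ m * ?v n) \<longlonglongrightarrow> 1"
    using even_counts_prob[OF B(2), of _ p] B(3) by simp
  then have "(\<lambda>n. (1 / 2) ^ m * (2 ^ m * ?v n)) \<longlonglongrightarrow> (1 / 2) ^ m * 1"
    by (rule tendsto_mult_left)
  then have "?v \<longlonglongrightarrow> (1 / 2) ^ m"
    by (simp add: power_divide)
  then have "\<forall>\<^sub>F n in sequentially. ?v n < e"
    using m by (rule order_tendstoD)
  then obtain n0 where n0: "\<And>n. n \<ge> n0 \<Longrightarrow> ?v n < e"
    by (auto simp: eventually_sequentially)
  have "k \<ge> 1" if "k \<in> B" for k
    using that B(1) by (cases k) auto
  then have "closed_prob p n \<le> ?v n" for n
    unfolding closed_prob_def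
    by (intro measure_pmf.finite_measure_mono) (auto simp: closed_word_def)
  with n0 have "norm (closed_prob p n - 0) < e" if "n \<ge> n0" for n
    using that by (simp add: closed_prob_def) (meson le_less_trans)
  then show "\<exists>n0. \<forall>n\<ge>n0. norm (closed_prob p n - 0) < e"
    by blast
qed

section \<open>The tail probabilities of the return time are not summable\<close>

text \<open>
  Summability would allow the limit \<open>N \<rightarrow> \<infinity>\<close> to be taken termwise in the renewal identity, with
  \<open>return_free_prob p\<close> as the dominating sequence; every term tends to 0, but the sum is 1.
\<close>

lemma return_free_prob_not_summable:
  assumes "infinite (set_pmf p)"
  shows "\<not> summable (return_free_prob p)"
proof
  assume summ: "summable (return_free_prob p)"
  define a where "a = (\<lambda>j N. if j \<le> N then return_free_prob p j * closed_prob p (N - j) else 0)"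
  have "(\<lambda>N. suminf (\<lambda>j. a j N)) \<longlonglongrightarrow> suminf (\<lambda>j. 0 :: real)"
  proof (rule conjunct2[OF conjunct2[OF tannerys_theorem[where M = "return_free_prob p"]]])
    fix j
    have "(\<lambda>i. a j (i + j)) \<longlonglongrightarrow> return_free_prob p j * 0"
      unfolding a_def by (simp, intro tendsto_mult_right_zero closed_prob_tendsto_0 assms)
    then show "(\<lambda>N. a j N) \<longlonglongrightarrow> 0"
      by (simp add: LIMSEQ_offset)
  next
    show "\<forall>\<^sub>F (j, N) in at_top \<times>\<^sub>F sequentially. norm (a j N) \<le> return_free_prob p j"
      by (rule always_eventually)
         (auto simp: a_def closed_prob_def return_free_prob_def abs_mult intro!: mult_left_le)
  qed (use summ in auto)
  moreover have "suminf (\<lambda>j. a j N) = 1" for N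
  proof -
    have "suminf (\<lambda>j. a j N) = (\<Sum>j\<le>N. a j N)"
      by (rule suminf_finite) (auto simp: a_def)
    also have "\<dots> = (\<Sum>j\<le>N. a (N - j) N)"
      by (rule sum.reindex_bij_witness[where i = "\<lambda>j. N - j" and j = "\<lambda>j. N - j"]) auto
    also have "\<dots> = (\<Sum>n\<le>N. closed_prob p n * return_free_prob p (N - n))"
      by (rule sum.cong) (auto simp: a_def)
    finally show ?thesis
      by (simp add: renewal_identity)
  qed
  ultimately show False
    by (simp add: LIMSEQ_const_iff)
qed

section \<open>From words to the chain\<close>

definition flips :: "(nat \<Rightarrow> 'a \<Rightarrow> nat) \<Rightarrow> nat \<Rightarrow> 'a \<Rightarrow> nat list" where
  "flips X n \<omega> = map (\<lambda>i. X (Suc i) \<omega>) [0..<n]"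

lemma bf_chain_eq_parity: "bf_chain X n \<omega> k = int (count_list (flips X n \<omega>) k mod 2)"
  by (induction n) (auto simp: flips_def mod_Suc)

lemma less_bf_return_time_iff:
  "enat t < bf_return_time X \<omega> \<longleftrightarrow> return_free (flips X t \<omega>)"
proof -
  let ?P = "\<lambda>n. n \<ge> 1 \<and> closed_word (flips X n \<omega>)"
  have set: "{enat n | n. n \<ge> 1 \<and> (\<forall>k\<ge>1. bf_chain X n \<omega> k = 0)} = enat ` {n. ?P n}"
    by (auto simp: bf_chain_eq_parity closed_word_def even_iff_mod_2_eq_zero)
  have "enat t < bf_return_time X \<omega> \<longleftrightarrow> eSuc (enat t) \<le> Inf (enat ` {n. ?P n})"
    unfolding bf_return_time_def set by (simp add: ileI1 iless_Suc_eq eSuc_enat Suc_ile_eq)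
  also have "\<dots> \<longleftrightarrow> (\<forall>n. ?P n \<longrightarrow> t < n)"
    by (auto simp: le_Inf_iff eSuc_enat Suc_le_eq)
  also have "\<dots> \<longleftrightarrow> (\<forall>j\<in>{1..t}. \<not> closed_word (flips X j \<omega>))"
    by (auto simp: not_less[symmetric])
  also have "\<dots> \<longleftrightarrow> return_free (flips X t \<omega>)"
    by (auto simp: return_free_def flips_def take_map)
  finally show ?thesis .
qed

lemma pmf_replicate_pmf:
  "length ys = n \<Longrightarrow> pmf (replicate_pmf n p) ys = (\<Prod>i<n. pmf p (ys ! i))"
proof (induction n arbitrary: ys)
  case (Suc n)
  then obtain z zs where ys: "ys = z # zs" "length zs = n"
    by (cases ys) auto
  have "pmf (replicate_pmf (Suc n) p) ys =
        pmf (map_pmf (\<lambda>(x, xs). x # xs) (pair_pmf p (replicate_pmf n p))) ((\<lambda>(x, xs). x # xs) (z, zs))"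
    by (simp add: replicate_pmf_Suc_pair ys del: replicate_pmf.simps)
  also have "\<dots> = pmf p z * pmf (replicate_pmf n p) zs"
    by (subst pmf_map_inj') (auto simp: inj_def pmf_pair)
  finally show ?case
    using Suc.IH[OF ys(2)]
    by (simp add: ys prod.lessThan_Suc_shift del: prod.lessThan_Suc replicate_pmf.simps)
qed simp

text \<open>
  This transfers probabilities from the abstract sample space to the law of random words.  As
  there are countably many words, it suffices to compare the probabilities of single words,
  where independence gives the product of the letter probabilities on both sides.
\<close>

lemma
  assumes "iid_with_law M p X"
  shows measurable_flips: "flips X n \<in> measurable M (count_space UNIV)"
    and distr_flips: "distr M (count_space UNIV) (flips X n) = measure_pmf (replicate_pmf n p)"
proof -
  interpret prob_space M
    using assms by (simp add: iid_with_law_def)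
  have indep: "indep_vars (\<lambda>_. count_space UNIV) X {1..}"
    using assms by (auto simp: iid_with_law_def)
  have law: "prob (X i -` {k} \<inter> space M) = pmf p k" if "i \<ge> 1" for i k
  proof -
    have "X i -` {k} \<inter> space M = {\<omega> \<in> space M. X i \<omega> = k}"
      by auto
    with assms that show ?thesis
      by (simp add: iid_with_law_def)
  qed
  have X: "X i \<in> measurable M (count_space UNIV)" if "i \<ge> 1" for i
    using indep that by (auto simp: indep_vars_def)
  have flips_eq_iff: "flips X n \<omega> = ys \<longleftrightarrow> length ys = n \<and> (\<forall>i<n. X (Suc i) \<omega> = ys ! i)" for \<omega> ys
    unfolding flips_def list_eq_iff_nth_eq by auto
  have wrong_length: "flips X n -` {ys} \<inter> space M = {}" if "length ys \<noteq> n" for ys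
    using that by (auto simp: flips_def)
  have "flips X n -` {ys} \<inter> space M \<in> sets M" for ys
  proof -
    have single: "{\<omega> \<in> space M. X (Suc i) \<omega> = k} \<in> sets M" for i k
    proof -
      have "{\<omega> \<in> space M. X (Suc i) \<omega> = k} = X (Suc i) -` {k} \<inter> space M"
        by auto
      then show ?thesis
        using measurable_sets[OF X[of "Suc i"], of "{k}"] by simp
    qed
    have meas_all: "{\<omega> \<in> space M. \<forall>i\<in>{..<n}. X (Suc i) \<omega> = ys ! i} \<in> sets M"
    proof (rule sets.sets_Collect_finite_All)
      show "{\<omega> \<in> space M. X (Suc i) \<omega> = ys ! i} \<in> sets M" for i
        by (rule single)
    qed simp
    show ?thesis
    proof (cases "length ys = n")
      case True
      then have "flips X n -` {ys} \<inter> space M = {\<omega> \<in> space M. \<forall>i\<in>{..<n}. X (Suc i) \<omega> = ys ! i}"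
        by (intro set_eqI) (auto simp: flips_eq_iff)
      then show ?thesis
        by (simp only: meas_all)
    next
      case False
      show ?thesis
        unfolding wrong_length[OF False] by (rule sets.empty_sets)
    qed
  qed
  then show meas: "flips X n \<in> measurable M (count_space UNIV)"
    by (simp add: measurable_count_space_eq2_countable)
  have prob: "prob (flips X n -` {ys} \<inter> space M) = pmf (replicate_pmf n p) ys" for ys
  proof (cases "length ys = n")
    case False
    then have "ys \<notin> set_pmf (replicate_pmf n p)"
      by (simp add: set_replicate_pmf)
    with False show ?thesis
      by (simp add: wrong_length set_pmf_iff)
  next
    case len: True
    show ?thesis
    \<comment> \<open>The product rule for independent variables needs a nonempty index set.\<close>
    proof (cases "n = 0")
      case True
      with len have "flips X n -` {ys} \<inter> space M = space M"
        by (auto simp: flips_def)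
      with True len show ?thesis
        by (simp add: prob_space)
    next
      case False
      let ?I = "Suc ` {..<n}"
      have "flips X n -` {ys} \<inter> space M = (\<Inter>i\<in>?I. X i -` {ys ! (i - 1)} \<inter> space M)"
        using False len by (intro set_eqI) (auto simp: flips_eq_iff)
      also have "prob \<dots> = (\<Prod>i\<in>?I. prob (X i -` {ys ! (i - 1)} \<inter> space M))"
        by (rule indep_varsD[OF indep]) (use False in auto)
      also have "\<dots> = (\<Prod>i<n. pmf p (ys ! i))"
        by (simp add: prod.reindex law)
      finally show ?thesis
        by (simp add: pmf_replicate_pmf len)
    qed
  qed
  show "distr M (count_space UNIV) (flips X n) = measure_pmf (replicate_pmf n p)"
  proof (rule measure_eqI_countable[where A = UNIV])
    fix ys :: "nat list"
    show "emeasure (distr M (count_space UNIV) (flips X n)) {ys} =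
          emeasure (measure_pmf (replicate_pmf n p)) {ys}"
      using meas by (simp add: emeasure_distr emeasure_eq_measure prob emeasure_pmf_single)
  qed auto
qed

lemma sum_indicator_le_enat:
  "(\<Sum>t<N. indicator {t. enat t < e} t) \<le> ennreal_of_enat e"
proof (cases e)
  case (enat k)
  have "(\<Sum>t<N. indicator {t. enat t < e} t) = (of_nat (card ({..<N} \<inter> {t. t < k})) :: ennreal)"
    by (simp add: enat indicator_def sum.If_cases)
  also have "card ({..<N} \<inter> {t. t < k}) \<le> card {..<k}"
    by (rule card_mono) auto
  then have "(of_nat (card ({..<N} \<inter> {t. t < k})) :: ennreal) \<le> of_nat k"
    by (simp add: of_nat_mono)
  finally show ?thesis
    by (simp add: enat)
qed simp

text \<open>
  Truncated form of the tail formula for expectations.  It comes from a pointwise inequality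
  with a finite sum of indicators of the events \<open>t < bf_return_time X \<omega>\<close>, so only these events
  have to be measurable.
\<close>

lemma sum_return_free_prob_le:
  assumes "iid_with_law M p X"
  shows "ennreal (\<Sum>t<N. return_free_prob p t) \<le> bf_expected_return_time M X"
proof -
  interpret prob_space M
    using assms by (simp add: iid_with_law_def)
  let ?T = "\<lambda>t. flips X t -` {xs. return_free xs} \<inter> space M"
  have sets: "?T t \<in> sets M" for t
    by (rule measurable_sets[OF measurable_flips[OF assms]]) simp
  have "emeasure M (?T t) = ennreal (return_free_prob p t)" for t
    using emeasure_distr[OF measurable_flips[OF assms], of "{xs. return_free xs}" t]
    by (simp add: distr_flips[OF assms] return_free_prob_def measure_pmf.emeasure_eq_measure)
  then have "ennreal (\<Sum>t<N. return_free_prob p t) = (\<Sum>t<N. emeasure M (?T t))"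
    by (simp add: sum_ennreal return_free_prob_def)
  also have "\<dots> = (\<integral>\<^sup>+ \<omega>. (\<Sum>t<N. indicator (?T t) \<omega>) \<partial>M)"
    using sets by (subst nn_integral_sum) auto
  also have "\<dots> \<le> (\<integral>\<^sup>+ \<omega>. ennreal_of_enat (bf_return_time X \<omega>) \<partial>M)"
  proof (rule nn_integral_mono)
    fix \<omega> assume "\<omega> \<in> space M"
    then have "(\<Sum>t<N. indicator (?T t) \<omega>) =
        (\<Sum>t<N. indicator {t. enat t < bf_return_time X \<omega>} t :: ennreal)"
      by (intro sum.cong) (auto simp: less_bf_return_time_iff indicator_def)
    then show "(\<Sum>t<N. indicator (?T t) \<omega>) \<le> ennreal_of_enat (bf_return_time X \<omega>)"
      by (simp only: sum_indicator_le_enat)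
  qed
  finally show ?thesis
    by (simp only: bf_expected_return_time_def)
qed

lemma expected_return_time_infinite:
  assumes "infinite (set_pmf p)" and "iid_with_law M p X"
  shows "bf_expected_return_time M X = \<infinity>"
proof (rule ccontr)
  assume "bf_expected_return_time M X \<noteq> \<infinity>"
  then obtain c where c: "bf_expected_return_time M X = ennreal c" "c \<ge> 0"
    by (cases "bf_expected_return_time M X") auto
  have nonneg: "0 \<le> return_free_prob p t" for t
    by (simp add: return_free_prob_def)
  have "summable (return_free_prob p)"
  proof (rule summableI_nonneg_bounded)
    fix N
    show "(\<Sum>t<N. return_free_prob p t) \<le> c"
      using sum_return_free_prob_le[OF assms(2), of N] c by (simp add: ennreal_le_iff)
  qed (rule nonneg)
  with return_free_prob_not_summable[OF assms(1)] show False
    by contradiction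
qed

theorem theorem2p2:
  fixes M :: "'a measure" and p :: "nat pmf" and X :: "nat \<Rightarrow> 'a \<Rightarrow> nat"
  assumes "set_pmf p \<subseteq> {1..}"
    and "\<And>j k. 1 \<le> j \<Longrightarrow> j \<le> k \<Longrightarrow> pmf p k \<le> pmf p j"
    and "\<not> bdd_above (set_pmf p)"
    and "iid_with_law M p X"
  shows "(bf_recurrent M X \<longrightarrow> bf_null_recurrent M X) \<and> bf_expected_return_time M X = \<infinity>"
proof -
  have "infinite (set_pmf p)"
    using assms(3) by (auto simp: bdd_above_nat)
  then have "bf_expected_return_time M X = \<infinity>"
    using assms(4) by (rule expected_return_time_infinite)
  then show ?thesis
    by (simp add: bf_null_recurrent_def)
qed

end
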